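(* For every $Q$ and $n$ there exist an integer $N=N(Q,n)$, a constant $C(n,Q)$ and an injective map $\xi:\mathcal{A}_Q(\mathbb{R}^n)\to\mathbb{R}^N$ such that: (i) $\mathrm{Lip}(\xi)\le 1$; (ii) if $\mathcal{Q}=\xi(\mathcal{A}_Q(\mathbb{R}^n))$, then $\mathrm{Lip}(\xi^{-1}|_{\mathcal{Q}})\le C(n,Q)$. Moreover, there exists a Lipschitz map $\rho:\mathbb{R}^N\to\mathcal{Q}$ which is the identity on $\mathcal{Q}$.
   Context: For $P\in\mathbb{R}^n$, $[[P]]$ denotes the Dirac mass at $P$, and $\mathcal{A}_Q(\mathbb{R}^n)=\{\sum_{i=1}^Q[[P_i]] : P_i\in\mathbb{R}^n\}$ (unordered $Q$-tuples, repetitions allowed), with the metric $\mathcal{G}(\sum_i[[P_i]],\sum_i[[S_i]])=\min_{\sigma}\sqrt{\sum_i|P_i-S_{\sigma(i)}|^2}$, the minimum being over all permutations $\sigma$ of $\{1,\dots,Q\}$. Lipschitz constants are with respect to $\mathcal{G}$ and the Euclidean metric. *)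

theory Defs
  imports "HOL-Analysis.Analysis" "HOL-Combinatorics.Permutations"
begin

(* The target dimension N is existentially quantified, so it cannot be a type. R^n and R^N are
   both modelled by the carrier of the library's Euclidean_space n, i.e. the x :: nat => real with x i = 0 for all i >= n.
   The type nat => real also carries a dist of its own (Function_Metric), which is not the
   Euclidean one and is not used here. *)

abbreviation Rn :: "nat \<Rightarrow> (nat \<Rightarrow> real) set"
  where "Rn n \<equiv> topspace (Euclidean_space n)"

definition edist :: "nat \<Rightarrow> (nat \<Rightarrow> real) \<Rightarrow> (nat \<Rightarrow> real) \<Rightarrow> real"
  where "edist n x y = L2_set (\<lambda>i. x i - y i) {..<n}"

(* A sum of Q Dirac masses is an atomic measure with natural-number weights; it is represented by
   the multiset of its atoms, the Dirac mass at P being {#P#}. *)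

definition dirac_sum :: "nat \<Rightarrow> (nat \<Rightarrow> 'a) \<Rightarrow> 'a multiset"
  where "dirac_sum Q P = (\<Sum>i<Q. {#P i#})"

definition AQ :: "nat \<Rightarrow> nat \<Rightarrow> (nat \<Rightarrow> real) multiset set"
  where "AQ Q n = {dirac_sum Q P | P. \<forall>i<Q. P i \<in> Rn n}"

definition matching_dist ::
    "nat \<Rightarrow> nat \<Rightarrow> (nat \<Rightarrow> nat \<Rightarrow> real) \<Rightarrow> (nat \<Rightarrow> nat \<Rightarrow> real) \<Rightarrow> real"
  where "matching_dist Q n P S =
    (MIN \<sigma>\<in>{\<sigma>. \<sigma> permutes {..<Q}}. sqrt (\<Sum>i<Q. (edist n (P i) (S (\<sigma> i)))\<^sup>2))"

(* The value does not depend on the enumerations P and S: see GQ_dirac_sum. *)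

definition GQ ::
    "nat \<Rightarrow> nat \<Rightarrow> (nat \<Rightarrow> real) multiset \<Rightarrow> (nat \<Rightarrow> real) multiset \<Rightarrow> real"
  where "GQ Q n T U =
    (THE r. \<exists>P S. T = dirac_sum Q P \<and> U = dirac_sum Q S \<and> r = matching_dist Q n P S)"

(* Lip(f) <= L on X. The library's lipschitz_on needs type-class metrics; here the distances
   are explicit. *)

definition Lip_le ::
    "real \<Rightarrow> 'a set \<Rightarrow> ('a \<Rightarrow> 'a \<Rightarrow> real) \<Rightarrow> ('b \<Rightarrow> 'b \<Rightarrow> real) \<Rightarrow> ('a \<Rightarrow> 'b) \<Rightarrow> bool"
  where "Lip_le L X dX dY f \<longleftrightarrow> 0 \<le> L \<and> (\<forall>x\<in>X. \<forall>y\<in>X. dY (f x) (f y) \<le> L * dX x y)"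

lemma dirac_sum_eq_mset: "dirac_sum Q P = mset (map P [0..<Q])"
  by (induction Q) (auto simp: dirac_sum_def)

lemma dirac_sum_eqD:
  assumes "dirac_sum Q P = dirac_sum Q P'"
  obtains \<tau> where "\<tau> permutes {..<Q}" "\<And>i. i < Q \<Longrightarrow> P' i = P (\<tau> i)"
proof -
  have "mset (map P' [0..<Q]) = mset (map P [0..<Q])"
    using assms by (simp only: dirac_sum_eq_mset)
  then obtain p where p: "p permutes {..<length (map P [0..<Q])}"
      "permute_list p (map P [0..<Q]) = map P' [0..<Q]"
    by (rule mset_eq_permutation)
  have "P' i = P (p i)" if "i < Q" for i
  proof -
    have "p i < Q"
      using p(1) that permutes_in_image[of p "{..<Q}" i] by simp
    have "map P' [0..<Q] ! i = map P [0..<Q] ! p i"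
      using permute_list_nth[OF p(1), of i] p(2) that by simp
    then show ?thesis
      using that \<open>p i < Q\<close> by simp
  qed
  then show ?thesis
    using that p(1) by simp
qed

lemma matching_dist_permute:
  assumes \<tau>: "\<tau> permutes {..<Q}" "\<And>i. i < Q \<Longrightarrow> P' i = P (\<tau> i)"
    and \<upsilon>: "\<upsilon> permutes {..<Q}" "\<And>i. i < Q \<Longrightarrow> S' i = S (\<upsilon> i)"
  shows "matching_dist Q n P' S' = matching_dist Q n P S"
proof -
  let ?c = "\<lambda>P S \<sigma>. sqrt (\<Sum>i<Q. (edist n (P i) (S (\<sigma> i)))\<^sup>2)"
  let ?h = "\<lambda>\<sigma>. \<upsilon> \<circ> (\<sigma> \<circ> inv \<tau>)"
  have h: "?c P' S' \<sigma> = ?c P S (?h \<sigma>)" if \<sigma>: "\<sigma> permutes {..<Q}" for \<sigma>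
  proof -
    have "(\<Sum>i<Q. (edist n (P' i) (S' (\<sigma> i)))\<^sup>2)
        = (\<Sum>i<Q. (edist n (P (\<tau> i)) (S (?h \<sigma> (\<tau> i))))\<^sup>2)"
    proof (rule sum.cong)
      fix i assume "i \<in> {..<Q}"
      then have "\<sigma> i < Q"
        using permutes_in_image[OF \<sigma>] by auto
      then have "P' i = P (\<tau> i)" "S' (\<sigma> i) = S (\<upsilon> (\<sigma> i))"
        using \<open>i \<in> {..<Q}\<close> \<tau>(2) \<upsilon>(2) by auto
      then show "(edist n (P' i) (S' (\<sigma> i)))\<^sup>2 = (edist n (P (\<tau> i)) (S (?h \<sigma> (\<tau> i))))\<^sup>2"
        by (simp only: o_apply permutes_inverses(2)[OF \<tau>(1)])
    qed simp
    also have "\<dots> = (\<Sum>i<Q. (edist n (P i) (S (?h \<sigma> i)))\<^sup>2)"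
      using sum.permute[OF \<tau>(1), of "\<lambda>i. (edist n (P i) (S (?h \<sigma> i)))\<^sup>2"]
      by (simp add: o_def)
    finally show ?thesis by simp
  qed
  have "?h ` {\<sigma>. \<sigma> permutes {..<Q}} = {\<sigma>. \<sigma> permutes {..<Q}}"
  proof (intro equalityI subsetI)
    fix \<rho> assume \<rho>: "\<rho> \<in> {\<sigma>. \<sigma> permutes {..<Q}}"
    let ?s = "inv \<upsilon> \<circ> (\<rho> \<circ> \<tau>)"
    have "?s permutes {..<Q}"
      using \<rho> \<tau>(1) \<upsilon>(1) by (simp add: permutes_compose permutes_inv)
    moreover have "\<rho> = ?h ?s"
      by (simp add: fun_eq_iff permutes_inverses(1)[OF \<tau>(1)] permutes_inverses(1)[OF \<upsilon>(1)])
    ultimately show "\<rho> \<in> ?h ` {\<sigma>. \<sigma> permutes {..<Q}}"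
      by (intro image_eqI[of _ _ ?s] CollectI)
  next
    fix \<rho> assume "\<rho> \<in> ?h ` {\<sigma>. \<sigma> permutes {..<Q}}"
    then show "\<rho> \<in> {\<sigma>. \<sigma> permutes {..<Q}}"
      using permutes_compose permutes_inv[OF \<tau>(1)] \<upsilon>(1) by blast
  qed
  then have "?c P S ` {\<sigma>. \<sigma> permutes {..<Q}} = (\<lambda>\<sigma>. ?c P S (?h \<sigma>)) ` {\<sigma>. \<sigma> permutes {..<Q}}"
    using image_image[of "?c P S" ?h "{\<sigma>. \<sigma> permutes {..<Q}}"] by simp
  also have "\<dots> = ?c P' S' ` {\<sigma>. \<sigma> permutes {..<Q}}"
    by (rule image_cong) (simp_all only: h mem_Collect_eq)
  finally show ?thesis
    unfolding matching_dist_def by simp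
qed

lemma GQ_dirac_sum: "GQ Q n (dirac_sum Q P) (dirac_sum Q S) = matching_dist Q n P S"
  unfolding GQ_def
proof (rule the_equality)
  fix r
  assume "\<exists>P' S'. dirac_sum Q P = dirac_sum Q P' \<and> dirac_sum Q S = dirac_sum Q S' \<and>
            r = matching_dist Q n P' S'"
  then obtain P' S' where eq: "dirac_sum Q P = dirac_sum Q P'" "dirac_sum Q S = dirac_sum Q S'"
    and r: "r = matching_dist Q n P' S'" by blast
  obtain \<tau> where "\<tau> permutes {..<Q}" "\<And>i. i < Q \<Longrightarrow> P' i = P (\<tau> i)"
    using dirac_sum_eqD[OF eq(1)] by blast
  moreover obtain \<upsilon> where "\<upsilon> permutes {..<Q}" "\<And>i. i < Q \<Longrightarrow> S' i = S (\<upsilon> i)"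
    using dirac_sum_eqD[OF eq(2)] by blast
  ultimately show "r = matching_dist Q n P S"
    unfolding r by (rule matching_dist_permute)
qed blast

end

theory Submission
  imports Defs "HOL-Computational_Algebra.Polynomial"
begin

text \<open>
  The embedding. A point of \<open>AQ Q 1\<close> is determined by its sorted list of atoms, and sorting is
  1-Lipschitz: this is \<open>ranked_lipschitz\<close>. In dimension \<open>n\<close> the atoms are therefore projected by
  finitely many linear functionals, and the embedding records the sorted list of the values of each.
  It is Lipschitz because sorting is. Conversely, if two sorted lists of values of one functional are
  close, then pairing the atoms by rank pairs points whose difference has a small value; so it is
  enough that, for any two \<open>Q\<close>-tuples, one of the functionals controls the full length of
  all \<open>Q * Q\<close> differences of atoms at once. The functionals
  \<open>v \<mapsto> v\<^sub>0 + v\<^sub>1 t + \<dots>\<close> with \<open>t = 0, \<dots>, Q * Q * n\<close> have this property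
  (\<open>exists_good_moment\<close>): \<open>v\<close> is a polynomial with at most \<open>n\<close> coefficients, hence is
  controlled by its values at any \<open>n\<close> of these integers, and so fails at no more than \<open>n\<close> of them.

  The retraction. Fix \<open>x\<close> in the ambient space and let \<open>c P\<close> be a multiple of the distance from \<open>x\<close>
  to the image of the tuple \<open>P\<close>, scaled so that the atoms of any two tuples \<open>P\<close> and \<open>S\<close> can be paired
  within \<open>c P + c S\<close>. A point \<open>a\<close> is active at level \<open>s\<close> if it is an atom of some \<open>P\<close> with
  \<open>c P \<le> s\<close>; active points at distance at most \<open>2 * s\<close> are linked, and chains of
  links form clusters, which grow with \<open>s\<close>. All active points lie near the \<open>Q\<close> atoms of one tuple, so
  clusters at level \<open>s\<close> have diameter at most a multiple \<open>slope Q * s\<close>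
  (\<open>clustered_close\<close>). Each atom \<open>a\<close> of a nearest tuple is now moved, coordinate by coordinate, to
  the infimum of \<open>b j + slope Q * s\<close> over all \<open>b\<close> that lie in the cluster of \<open>a\<close> at
  some level \<open>s\<close>. This is McShane's formula for extending a real Lipschitz function, with the level at
  which two points merge in place of their distance. If \<open>x\<close> is itself an image, then \<open>a\<close>
  is active at level 0 and the diameter bound makes \<open>a j\<close> the infimum, so nothing moves
  (\<open>settle_eq\<close>). If \<open>x\<close> moves by a small amount \<open>d\<close>, measured by \<open>c\<close>, then the clusters at level
  \<open>s\<close> for one point are contained in those at level \<open>s + d\<close> for the other. The nearest tuple
  may jump, but the atoms of the old and new ones are paired within clusters at a level exceeding the
  lowest level with active points by only \<open>2 * d\<close>, so all infima change by at most a multiple of \<open>d\<close>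
  (\<open>settle_lipschitz\<close>). No decomposition of the ambient space is involved, because
  the infimum does the work of a partition of unity.
\<close>

section \<open>Matched tuples\<close>

text \<open>
  Closeness is measured coordinatewise: the sup norm is the one for which infima of coordinates and
  sorted lists of projections have clean estimates, and it changes all constants only by
  factors depending on \<open>Q\<close> and \<open>n\<close>.
\<close>

definition close :: "nat \<Rightarrow> real \<Rightarrow> (nat \<Rightarrow> real) \<Rightarrow> (nat \<Rightarrow> real) \<Rightarrow> bool"
  where "close n e a b \<longleftrightarrow> (\<forall>j<n. \<bar>a j - b j\<bar> \<le> e)"

definition matched ::
    "nat \<Rightarrow> nat \<Rightarrow> real \<Rightarrow> (nat \<Rightarrow> nat \<Rightarrow> real) \<Rightarrow> (nat \<Rightarrow> nat \<Rightarrow> real) \<Rightarrow> bool"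
  where "matched Q n e P S \<longleftrightarrow>
    (\<exists>\<sigma>. \<sigma> permutes {..<Q} \<and> (\<forall>i<Q. close n e (P i) (S (\<sigma> i))))"

lemma close_sym: "close n e a b \<Longrightarrow> close n e b a"
  by (simp add: close_def abs_minus_commute)

lemma close_mono: "close n e a b \<Longrightarrow> e \<le> e' \<Longrightarrow> close n e' a b"
  by (force simp: close_def)

lemma close_trans: "close n e a b \<Longrightarrow> close n e' b c \<Longrightarrow> close n (e + e') a c"
  unfolding close_def by (smt (verit))

lemma matched_mono: "matched Q n e P S \<Longrightarrow> e \<le> e' \<Longrightarrow> matched Q n e' P S"
  unfolding matched_def using close_mono by blast

lemma edist_le_of_close:
  assumes "close n e a b"
  shows "edist n a b \<le> real n * e"
proof -
  have "edist n a b \<le> (\<Sum>j<n. \<bar>a j - b j\<bar>)"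
    unfolding edist_def by (rule L2_set_le_sum_abs)
  also have "\<dots> \<le> (\<Sum>j<n. e)"
    using assms by (intro sum_mono) (simp add: close_def)
  finally show ?thesis by simp
qed

lemma close_edist: "close n (edist n a b) a b"
proof -
  have "\<bar>a j - b j\<bar> \<le> edist n a b" if "j < n" for j
  proof -
    have "\<bar>a j - b j\<bar> \<le> L2_set (\<lambda>i. \<bar>a i - b i\<bar>) {..<n}"
      using that by (intro member_le_L2_set) auto
    then show ?thesis by (simp add: edist_def L2_set_def)
  qed
  then show ?thesis by (simp add: close_def)
qed

lemma edist_nonneg: "0 \<le> edist n a b"
  by (simp add: edist_def)

lemma edist_self: "edist n a a = 0"
  by (simp add: edist_def L2_set_def)

lemma edist_triangle: "edist n a c \<le> edist n a b + edist n b c"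
  using L2_set_triangle_ineq[of "\<lambda>i. a i - b i" "\<lambda>i. b i - c i" "{..<n}"]
  by (simp add: edist_def)

lemma edist_commute: "edist n a b = edist n b a"
  by (simp add: edist_def L2_set_def power2_commute)

lemma matching_dist_le_of_matched:
  assumes "matched Q n e P S"
  shows "matching_dist Q n P S \<le> real Q * (real n * e)"
proof -
  obtain \<sigma> where \<sigma>: "\<sigma> permutes {..<Q}" "\<forall>i<Q. close n e (P i) (S (\<sigma> i))"
    using assms by (auto simp: matched_def)
  have "matching_dist Q n P S \<le> sqrt (\<Sum>i<Q. (edist n (P i) (S (\<sigma> i)))\<^sup>2)"
    unfolding matching_dist_def using \<sigma>(1)
    by (intro Min_le finite_imageI finite_permutations) auto
  also have "\<dots> \<le> (\<Sum>i<Q. edist n (P i) (S (\<sigma> i)))"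
    using L2_set_le_sum[of "{..<Q}" "\<lambda>i. edist n (P i) (S (\<sigma> i))"]
    by (simp add: L2_set_def edist_nonneg)
  also have "\<dots> \<le> (\<Sum>i<Q. real n * e)"
    using \<sigma>(2) by (intro sum_mono edist_le_of_close) auto
  finally show ?thesis by simp
qed

lemma matched_matching_dist: "matched Q n (matching_dist Q n P S) P S"
proof -
  let ?c = "\<lambda>\<sigma>. sqrt (\<Sum>i<Q. (edist n (P i) (S (\<sigma> i)))\<^sup>2)"
  have "matching_dist Q n P S \<in> ?c ` {\<sigma>. \<sigma> permutes {..<Q}}"
    unfolding matching_dist_def
    by (intro Min_in finite_imageI finite_permutations) (auto intro: permutes_id)
  then obtain \<sigma> where \<sigma>: "\<sigma> permutes {..<Q}" "matching_dist Q n P S = ?c \<sigma>"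
    by auto
  have "close n (?c \<sigma>) (P i) (S (\<sigma> i))" if "i < Q" for i
  proof (rule close_mono[OF close_edist])
    show "edist n (P i) (S (\<sigma> i)) \<le> ?c \<sigma>"
      using member_le_L2_set[of "{..<Q}" i "\<lambda>i. edist n (P i) (S (\<sigma> i))"] that
      by (simp add: L2_set_def)
  qed
  then show ?thesis
    unfolding matched_def using \<sigma> by auto
qed

lemma matching_dist_nonneg: "0 \<le> matching_dist Q n P S"
  unfolding matching_dist_def
  by (subst Min_ge_iff) (auto intro: finite_permutations sum_nonneg permutes_id)

section \<open>Order statistics\<close>

definition ranked :: "real multiset \<Rightarrow> nat \<Rightarrow> real"
  where "ranked U k = sorted_list_of_multiset U ! k"

lemma image_mset_dirac_sum: "image_mset f (dirac_sum Q P) = dirac_sum Q (\<lambda>i. f (P i))"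
  by (simp only: dirac_sum_eq_mset mset_map[symmetric] map_map o_def)

lemma length_sorted_dirac_sum: "length (sorted_list_of_multiset (dirac_sum Q u)) = Q"
  by (metis dirac_sum_eq_mset diff_zero length_map length_upt mset_sorted_list_of_multiset size_mset)

lemma ranked_mono: "k \<le> l \<Longrightarrow> l < Q \<Longrightarrow> ranked (dirac_sum Q u) k \<le> ranked (dirac_sum Q u) l"
  unfolding ranked_def
  by (intro sorted_nth_mono) (simp_all add: length_sorted_dirac_sum sorted_sorted_list_of_multiset)

text \<open>
  Pairing equal ranks gives the permutation that inverts the embedding.
\<close>
lemma ranked_enumeration:
  obtains \<tau> where "\<tau> permutes {..<Q}" "\<And>k. k < Q \<Longrightarrow> ranked (dirac_sum Q u) k = u (\<tau> k)"
proof -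
  let ?l = "sorted_list_of_multiset (dirac_sum Q u)"
  have "map (ranked (dirac_sum Q u)) [0..<Q] = ?l"
    by (rule nth_equalityI) (simp_all add: length_sorted_dirac_sum ranked_def)
  then have "dirac_sum Q u = dirac_sum Q (ranked (dirac_sum Q u))"
    by (subst (2) dirac_sum_eq_mset) (metis mset_sorted_list_of_multiset)
  then show ?thesis
    by (rule dirac_sum_eqD) (rule that)
qed

text \<open>
  Among the \<open>k + 1\<close> smallest values of \<open>v\<close>, one is paired with a value of \<open>u\<close> of rank at least \<open>k\<close>,
  since only \<open>k\<close> values of \<open>u\<close> have smaller rank.
\<close>
lemma ranked_le:
  assumes \<sigma>: "\<sigma> permutes {..<Q}" and le: "\<And>i. i < Q \<Longrightarrow> u i \<le> v (\<sigma> i) + e" and k: "k < Q"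
  shows "ranked (dirac_sum Q u) k \<le> ranked (dirac_sum Q v) k + e"
proof -
  obtain \<tau> where \<tau>: "\<tau> permutes {..<Q}" "\<And>k. k < Q \<Longrightarrow> ranked (dirac_sum Q u) k = u (\<tau> k)"
    using ranked_enumeration[of Q u] by metis
  obtain \<upsilon> where \<upsilon>: "\<upsilon> permutes {..<Q}" "\<And>k. k < Q \<Longrightarrow> ranked (dirac_sum Q v) k = v (\<upsilon> k)"
    using ranked_enumeration[of Q v] by metis
  \<comment> \<open>\<open>\<pi> l\<close> is the rank of the value of \<open>u\<close> that \<open>\<sigma>\<close> pairs with the value of \<open>v\<close> of rank \<open>l\<close>.\<close>
  define \<pi> where "\<pi> = inv \<tau> \<circ> (inv \<sigma> \<circ> \<upsilon>)"
  have \<pi>: "\<pi> permutes {..<Q}"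
    unfolding \<pi>_def using \<tau>(1) \<sigma> \<upsilon>(1) by (intro permutes_compose permutes_inv)
  have \<pi>_eq: "\<sigma> (\<tau> (\<pi> l)) = \<upsilon> l" for l
    by (simp add: \<pi>_def permutes_inverses(1)[OF \<tau>(1)] permutes_inverses(1)[OF \<sigma>])
  have "\<exists>l\<le>k. k \<le> \<pi> l"
  proof (rule ccontr)
    assume "\<not> ?thesis"
    then have "\<pi> ` {..k} \<subseteq> {..<k}" by auto
    then have "card (\<pi> ` {..k}) \<le> k"
      using card_mono[of "{..<k}"] by fastforce
    moreover have "card (\<pi> ` {..k}) = Suc k"
      using card_image[OF permutes_inj_on[OF \<pi>]] by simp
    ultimately show False by simp
  qed
  then obtain l where l: "l \<le> k" "k \<le> \<pi> l" by blast
  have "\<pi> l < Q" "\<tau> (\<pi> l) < Q"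
    using permutes_in_image[OF \<pi>] permutes_in_image[OF \<tau>(1)] l k by auto
  have "ranked (dirac_sum Q u) k \<le> ranked (dirac_sum Q u) (\<pi> l)"
    using l \<open>\<pi> l < Q\<close> by (intro ranked_mono)
  also have "\<dots> \<le> ranked (dirac_sum Q v) l + e"
    using le[OF \<open>\<tau> (\<pi> l) < Q\<close>] \<open>\<pi> l < Q\<close> l k by (simp add: \<tau>(2) \<upsilon>(2) \<pi>_eq)
  also have "\<dots> \<le> ranked (dirac_sum Q v) k + e"
    using ranked_mono[OF l(1) k] by simp
  finally show ?thesis .
qed

lemma ranked_lipschitz:
  assumes \<sigma>: "\<sigma> permutes {..<Q}" and le: "\<And>i. i < Q \<Longrightarrow> \<bar>u i - v (\<sigma> i)\<bar> \<le> e" and k: "k < Q"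
  shows "\<bar>ranked (dirac_sum Q u) k - ranked (dirac_sum Q v) k\<bar> \<le> e"
proof -
  have "v i \<le> u (inv \<sigma> i) + e" if "i < Q" for i
    using le[of "inv \<sigma> i"] permutes_in_image[OF permutes_inv[OF \<sigma>], of i] that
      permutes_inverses(1)[OF \<sigma>, of i] by simp
  then have "ranked (dirac_sum Q v) k \<le> ranked (dirac_sum Q u) k + e"
    by (intro ranked_le[OF permutes_inv[OF \<sigma>]] k)
  moreover have "ranked (dirac_sum Q u) k \<le> ranked (dirac_sum Q v) k + e"
    using le by (intro ranked_le[OF \<sigma>] k) (simp add: abs_le_iff algebra_simps)
  ultimately show ?thesis by (simp add: abs_le_iff)
qed

section \<open>Finitely many projections that see all directions\<close>

text \<open>
  A quantitative form of uniqueness in interpolation. Dividing \<open>p - p(t)\<close> by \<open>x - t\<close> at one of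
  the nodes lowers the degree and at most doubles the values at the remaining nodes, because distinct
  integers differ by at least 1.
\<close>
lemma poly_coeff_bound:
  "\<exists>K\<ge>0. \<forall>(p :: real poly) A e. card A = n \<and> A \<subseteq> {..M} \<and> (\<forall>i\<ge>n. coeff p i = 0) \<and>
      (\<forall>t\<in>A. \<bar>poly p (real t)\<bar> \<le> e) \<longrightarrow> (\<forall>i. \<bar>coeff p i\<bar> \<le> K * e)"
proof (induction n)
  case 0
  show ?case by (intro exI[of _ 0]) auto
next
  case (Suc n)
  from Suc.IH obtain K where K_bound: "K \<ge> 0 \<and> (\<forall>(p :: real poly) A e. card A = n \<and> A \<subseteq> {..M} \<and>
      (\<forall>i\<ge>n. coeff p i = 0) \<and> (\<forall>t\<in>A. \<bar>poly p (real t)\<bar> \<le> e) \<longrightarrow> (\<forall>i. \<bar>coeff p i\<bar> \<le> K * e))" ..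
  then have K: "K \<ge> 0" ..
  have bound: "\<bar>coeff p i\<bar> \<le> K * e"
    if "card A = n" "A \<subseteq> {..M}" "\<forall>i\<ge>n. coeff p i = 0" "\<forall>t\<in>A. \<bar>poly p (real t)\<bar> \<le> e"
    for p :: "real poly" and A e i
    using K_bound[THEN conjunct2, THEN spec, of p, THEN spec, of A, THEN spec, of e] that by simp
  show ?case
  proof (intro exI[of _ "2 * K + real M * (2 * K) + 1"] conjI allI impI)
    show "2 * K + real M * (2 * K) + 1 \<ge> 0" using K by simp
    fix p :: "real poly" and A e i
    assume asm: "card A = Suc n \<and> A \<subseteq> {..M} \<and> (\<forall>i\<ge>Suc n. coeff p i = 0) \<and>
      (\<forall>t\<in>A. \<bar>poly p (real t)\<bar> \<le> e)"
    then obtain t where t: "t \<in> A" by fastforce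
    define q where "q = synthetic_div p (real t)"
    have p: "p = [:- real t, 1:] * q + [:poly p (real t):]"
      unfolding q_def by (rule synthetic_div_correct'[symmetric])
    have e: "\<bar>poly p (real t)\<bar> \<le> e" using asm t by blast
    have "e \<ge> 0" using e by linarith
    have "degree p \<le> n" using asm by (intro degree_le) auto
    have q0: "coeff q i = 0" if "i \<ge> n" for i
    proof (cases "degree q < i")
      case True
      then show ?thesis by (rule coeff_eq_0)
    next
      case False
      then have "n = 0" "degree p = 0"
        using that \<open>degree p \<le> n\<close> by (auto simp: q_def degree_synthetic_div)
      then show ?thesis
        by (simp add: q_def synthetic_div_eq_0_iff[THEN iffD2])
    qed
    have q_le: "\<bar>coeff q i\<bar> \<le> K * (2 * e)" for i
    proof (rule bound[of "A - {t}"])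
      show "card (A - {t}) = n" using asm t by simp
      show "A - {t} \<subseteq> {..M}" using asm by blast
      show "\<forall>i\<ge>n. coeff q i = 0" using q0 by blast
      show "\<forall>u\<in>A - {t}. \<bar>poly q (real u)\<bar> \<le> 2 * e"
      proof
        fix u assume u: "u \<in> A - {t}"
        have eq: "poly p (real u) - poly p (real t) = (real u - real t) * poly q (real u)"
          by (subst p) (simp add: algebra_simps)
        have "1 \<le> \<bar>real u - real t\<bar>" using u by (cases "u < t") auto
        then have "\<bar>poly q (real u)\<bar> \<le> \<bar>real u - real t\<bar> * \<bar>poly q (real u)\<bar>"
          by (simp add: mult_le_cancel_right1)
        also have "\<dots> = \<bar>poly p (real u) - poly p (real t)\<bar>"
          by (simp add: eq abs_mult)
        also have "\<dots> \<le> 2 * e"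
        proof -
          have "\<bar>poly p (real u)\<bar> \<le> e" using asm u by blast
          with e show ?thesis by linarith
        qed
        finally show "\<bar>poly q (real u)\<bar> \<le> 2 * e" .
      qed
    qed
    have "\<bar>coeff p i\<bar> \<le> \<bar>coeff (pCons 0 q) i\<bar> + real t * \<bar>coeff q i\<bar> + \<bar>coeff [:poly p (real t):] i\<bar>"
    proof -
      have "coeff p i = coeff (pCons 0 q) i - real t * coeff q i + coeff [:poly p (real t):] i"
        by (subst p) simp
      moreover have "\<bar>real t * coeff q i\<bar> = real t * \<bar>coeff q i\<bar>" by (simp add: abs_mult)
      ultimately show ?thesis by linarith
    qed
    also have "\<dots> \<le> K * (2 * e) + real M * (K * (2 * e)) + e"
    proof (intro add_mono mult_mono)
      show "\<bar>coeff (pCons 0 q) i\<bar> \<le> K * (2 * e)"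
        using q_le K \<open>e \<ge> 0\<close> by (simp add: coeff_pCons split: nat.split)
      show "real t \<le> real M" using asm t by auto
      show "\<bar>coeff [:poly p (real t):] i\<bar> \<le> e"
        using e \<open>e \<ge> 0\<close> by (simp add: coeff_pCons split: nat.split)
    qed (use q_le in auto)
    finally show "\<bar>coeff p i\<bar> \<le> (2 * K + real M * (2 * K) + 1) * e"
      by (simp add: algebra_simps)
  qed
qed

definition moment :: "nat \<Rightarrow> nat \<Rightarrow> (nat \<Rightarrow> real) \<Rightarrow> real"
  where "moment n t v = (\<Sum>j<n. v j * real t ^ j)"

lemma moment_diff: "moment n t (\<lambda>j. a j - b j) = moment n t a - moment n t b"
  by (simp add: moment_def sum_subtractf left_diff_distrib)

lemma moment_le:
  assumes "close n e a b" "t \<le> M"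
  shows "\<bar>moment n t a - moment n t b\<bar> \<le> real n * (real (Suc M) ^ n * e)"
proof -
  have "\<bar>moment n t a - moment n t b\<bar> \<le> (\<Sum>j<n. \<bar>(a j - b j) * real t ^ j\<bar>)"
    unfolding moment_diff[symmetric] by (simp only: moment_def sum_abs)
  also have "\<dots> \<le> (\<Sum>j<n. real (Suc M) ^ n * e)"
  proof (rule sum_mono)
    fix j assume j: "j \<in> {..<n}"
    have "real t ^ j \<le> real (Suc M) ^ j" using assms(2) by (intro power_mono) auto
    also have "\<dots> \<le> real (Suc M) ^ n" using j by (intro power_increasing) auto
    finally have "\<bar>a j - b j\<bar> * real t ^ j \<le> e * real (Suc M) ^ n"
      using assms(1) j by (intro mult_mono) (auto simp: close_def intro: order_trans[OF abs_ge_zero])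
    then show "\<bar>(a j - b j) * real t ^ j\<bar> \<le> real (Suc M) ^ n * e"
      by (simp add: abs_mult mult.commute)
  qed
  finally show ?thesis by simp
qed

text \<open>
  Each vector is controlled at all but at most \<open>n\<close> of the nodes, by interpolation at the nodes where
  control fails, so the nodes outnumber the failures for all vectors of \<open>V\<close> together.
\<close>
lemma exists_good_moment:
  "\<exists>K\<ge>0. \<forall>V :: (nat \<Rightarrow> real) set. finite V \<and> card V * n \<le> M \<longrightarrow>
     (\<exists>t\<le>M. \<forall>v\<in>V. \<forall>j<n. \<bar>v j\<bar> \<le> K * \<bar>moment n t v\<bar>)"
proof -
  from poly_coeff_bound[of n M] obtain K where K_bound: "K \<ge> 0 \<and> (\<forall>(p :: real poly) A e. card A = n \<and> A \<subseteq> {..M} \<and>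
      (\<forall>i\<ge>n. coeff p i = 0) \<and> (\<forall>t\<in>A. \<bar>poly p (real t)\<bar> \<le> e) \<longrightarrow> (\<forall>i. \<bar>coeff p i\<bar> \<le> K * e))" ..
  then have K: "K \<ge> 0" ..
  have bound: "\<bar>coeff p i\<bar> \<le> K * e"
    if "card A = n" "A \<subseteq> {..M}" "\<forall>i\<ge>n. coeff p i = 0" "\<forall>t\<in>A. \<bar>poly p (real t)\<bar> \<le> e"
    for p :: "real poly" and A e i
    using K_bound[THEN conjunct2, THEN spec, of p, THEN spec, of A, THEN spec, of e] that by simp
  define bad where "bad v = {t \<in> {..M}. \<not> (\<forall>j<n. \<bar>v j\<bar> \<le> K * \<bar>moment n t v\<bar>)}" for v
  have card_bad: "card (bad v) \<le> n" for v
  proof (rule ccontr)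
    assume "\<not> ?thesis"
    then obtain A where A: "A \<subseteq> bad v" "card A = n"
      by (metis nat_le_linear obtain_subset_with_card_n)
    have "finite A" using A(1) by (rule finite_subset) (simp add: bad_def)
    show False
    proof (cases "n = 0")
      case True
      then have "bad v = {}" by (simp add: bad_def)
      with \<open>\<not> card (bad v) \<le> n\<close> show False by simp
    next
      case False
      define p where "p = (\<Sum>j<n. monom (v j) j)"
      have coeff_p: "coeff p i = (if i < n then v i else 0)" for i
        by (simp add: p_def coeff_sum)
      have poly_p: "poly p (real t) = moment n t v" for t
        by (simp add: p_def moment_def poly_sum poly_monom)
      let ?m = "\<lambda>t. \<bar>moment n t v\<bar>"
      have "A \<noteq> {}" using A False by auto
      then have "Max (?m ` A) \<in> ?m ` A" using \<open>finite A\<close> by (intro Max_in) auto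
      then obtain t where t: "t \<in> A" "Max (?m ` A) = ?m t" by blast
      have "\<bar>coeff p j\<bar> \<le> K * ?m t" for j
      proof (rule bound[OF A(2)])
        show "A \<subseteq> {..M}" using A(1) by (auto simp: bad_def)
        show "\<forall>i\<ge>n. coeff p i = 0" by (simp add: coeff_p)
        show "\<forall>u\<in>A. \<bar>poly p (real u)\<bar> \<le> ?m t"
          using \<open>finite A\<close> by (simp add: poly_p flip: t(2))
      qed
      then have "\<forall>j<n. \<bar>v j\<bar> \<le> K * ?m t" by (metis coeff_p)
      then show False using A(1) t(1) by (auto simp: bad_def)
    qed
  qed
  show ?thesis
  proof (intro exI[of _ K] conjI K allI impI)
    fix V :: "(nat \<Rightarrow> real) set" assume V: "finite V \<and> card V * n \<le> M"
    have "card (\<Union>v\<in>V. bad v) \<le> (\<Sum>v\<in>V. card (bad v))"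
      using V by (intro card_UN_le) simp
    also have "\<dots> \<le> card V * n"
      using sum_bounded_above[of V "\<lambda>v. card (bad v)" n] card_bad by simp
    also have "\<dots> < card {..M}" using V by simp
    finally have "\<not> {..M} \<subseteq> (\<Union>v\<in>V. bad v)"
      using V card_mono[of "\<Union>v\<in>V. bad v" "{..M}"] by (auto simp: bad_def)
    then obtain t where "t \<le> M" "t \<notin> (\<Union>v\<in>V. bad v)" by auto
    then show "\<exists>t\<le>M. \<forall>v\<in>V. \<forall>j<n. \<bar>v j\<bar> \<le> K * \<bar>moment n t v\<bar>"
      unfolding bad_def by blast
  qed
qed

section \<open>The embedding\<close>

abbreviation nodes :: "nat \<Rightarrow> nat \<Rightarrow> nat"
  where "nodes Q n \<equiv> Q * Q * n"

abbreviation edim :: "nat \<Rightarrow> nat \<Rightarrow> nat"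
  where "edim Q n \<equiv> Suc (nodes Q n) * Q"

text \<open>
  The coordinate with index \<open>t * Q + k\<close> is the value of rank \<open>k\<close> of the functional with node \<open>t\<close>;
  the factor \<open>\<kappa>\<close> is there to bring the Lipschitz constant down to at most 1.
\<close>
definition almgren :: "nat \<Rightarrow> nat \<Rightarrow> real \<Rightarrow> (nat \<Rightarrow> real) multiset \<Rightarrow> nat \<Rightarrow> real"
  where "almgren Q n \<kappa> T i =
    (if i < edim Q n then \<kappa> * ranked (image_mset (moment n (i div Q)) T) (i mod Q) else 0)"

lemma almgren_lipschitz:
  assumes "matched Q n e P S" "\<kappa> \<ge> 0"
  shows "edist (edim Q n) (almgren Q n \<kappa> (dirac_sum Q P)) (almgren Q n \<kappa> (dirac_sum Q S))
     \<le> real (edim Q n) * (\<kappa> * (real n * (real (Suc (nodes Q n)) ^ n * e)))"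
proof (rule edist_le_of_close, unfold close_def, intro allI impI)
  fix i assume i: "i < edim Q n"
  then have Q: "Q > 0" by (cases Q) auto
  have div: "i div Q \<le> nodes Q n"
    using less_mult_imp_div_less[OF i] by simp
  obtain \<sigma> where \<sigma>: "\<sigma> permutes {..<Q}" "\<forall>i<Q. close n e (P i) (S (\<sigma> i))"
    using assms(1) by (auto simp: matched_def)
  have "\<bar>ranked (dirac_sum Q (\<lambda>k. moment n (i div Q) (P k))) (i mod Q)
      - ranked (dirac_sum Q (\<lambda>k. moment n (i div Q) (S k))) (i mod Q)\<bar>
      \<le> real n * (real (Suc (nodes Q n)) ^ n * e)"
    using \<sigma>(2) Q by (intro ranked_lipschitz[OF \<sigma>(1)] moment_le div) auto
  then have "\<kappa> * \<bar>ranked (dirac_sum Q (\<lambda>k. moment n (i div Q) (P k))) (i mod Q)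
      - ranked (dirac_sum Q (\<lambda>k. moment n (i div Q) (S k))) (i mod Q)\<bar>
      \<le> \<kappa> * (real n * (real (Suc (nodes Q n)) ^ n * e))"
    using assms(2) by (rule mult_left_mono)
  then show "\<bar>almgren Q n \<kappa> (dirac_sum Q P) i - almgren Q n \<kappa> (dirac_sum Q S) i\<bar>
      \<le> \<kappa> * (real n * (real (Suc (nodes Q n)) ^ n * e))"
    using i assms(2) by (simp add: almgren_def image_mset_dirac_sum abs_mult flip: right_diff_distrib)
qed

text \<open>
  The functional to sort by depends on the pair \<open>P\<close>, \<open>S\<close>: it is one that controls all
  differences of an atom of \<open>P\<close> and an atom of \<open>S\<close>. This makes the bound apply to the pairing
  by rank, whichever pairing that turns out to be.
\<close>
lemma matched_of_almgren:
  assumes "\<kappa> > 0"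
  shows "\<exists>K\<ge>0. \<forall>P S. matched Q n
     (K * edist (edim Q n) (almgren Q n \<kappa> (dirac_sum Q P)) (almgren Q n \<kappa> (dirac_sum Q S))) P S"
proof -
  from exists_good_moment[of n "nodes Q n"]
  obtain K where K_good: "K \<ge> 0 \<and> (\<forall>V :: (nat \<Rightarrow> real) set. finite V \<and> card V * n \<le> nodes Q n \<longrightarrow>
     (\<exists>t\<le>nodes Q n. \<forall>v\<in>V. \<forall>j<n. \<bar>v j\<bar> \<le> K * \<bar>moment n t v\<bar>))" ..
  then have K: "K \<ge> 0" ..
  have good: "\<exists>t\<le>nodes Q n. \<forall>v\<in>V. \<forall>j<n. \<bar>v j\<bar> \<le> K * \<bar>moment n t v\<bar>"
    if "finite V" "card V * n \<le> nodes Q n" for V :: "(nat \<Rightarrow> real) set"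
    using K_good[THEN conjunct2, THEN spec, of V] that by simp
  have "matched Q n (K / \<kappa> * edist (edim Q n) (almgren Q n \<kappa> (dirac_sum Q P)) (almgren Q n \<kappa> (dirac_sum Q S))) P S"
    (is "matched Q n (K / \<kappa> * ?d) P S") for P S
  proof -
    define V where "V = (\<lambda>(i, k) j. P i j - S k j) ` ({..<Q} \<times> {..<Q})"
    have "card V \<le> Q * Q"
      unfolding V_def using card_image_le[of "{..<Q} \<times> {..<Q}"] by (simp add: card_cartesian_product)
    then have "card V * n \<le> nodes Q n" by simp
    moreover have "finite V" by (simp add: V_def)
    ultimately obtain t where t: "t \<le> nodes Q n" "\<forall>v\<in>V. \<forall>j<n. \<bar>v j\<bar> \<le> K * \<bar>moment n t v\<bar>"
      using good by blast
    obtain \<tau> where \<tau>: "\<tau> permutes {..<Q}"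
        "\<And>k. k < Q \<Longrightarrow> ranked (dirac_sum Q (\<lambda>i. moment n t (P i))) k = moment n t (P (\<tau> k))"
      using ranked_enumeration[of Q "\<lambda>i. moment n t (P i)"] by metis
    obtain \<upsilon> where \<upsilon>: "\<upsilon> permutes {..<Q}"
        "\<And>k. k < Q \<Longrightarrow> ranked (dirac_sum Q (\<lambda>i. moment n t (S i))) k = moment n t (S (\<upsilon> k))"
      using ranked_enumeration[of Q "\<lambda>i. moment n t (S i)"] by metis
    have "close n (K / \<kappa> * ?d) (P i) (S ((\<upsilon> \<circ> inv \<tau>) i))" if i: "i < Q" for i
    proof -
      define k where "k = inv \<tau> i"
      have k: "k < Q" "\<tau> k = i"
        using permutes_in_image[OF permutes_inv[OF \<tau>(1)], of i] i permutes_inverses(1)[OF \<tau>(1), of i]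
        by (simp_all add: k_def)
      have "\<upsilon> k < Q" using permutes_in_image[OF \<upsilon>(1), of k] k by simp
      have idx: "t * Q + k < edim Q n"
      proof -
        have "t * Q + k < Suc t * Q" using k by simp
        also have "\<dots> \<le> edim Q n" using t(1) by (intro mult_le_mono1) simp
        finally show ?thesis .
      qed
      have "\<kappa> * \<bar>moment n t (P i) - moment n t (S (\<upsilon> k))\<bar> \<le> ?d"
        using close_edist[of "edim Q n" "almgren Q n \<kappa> (dirac_sum Q P)" "almgren Q n \<kappa> (dirac_sum Q S)"]
          idx k \<tau>(2)[of k] \<upsilon>(2)[of k] assms
        by (auto simp: close_def almgren_def image_mset_dirac_sum abs_mult simp flip: right_diff_distrib
            dest!: spec[of _ "t * Q + k"])
      then have m: "\<bar>moment n t (P i) - moment n t (S (\<upsilon> k))\<bar> \<le> ?d / \<kappa>"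
        using assms by (simp add: field_simps)
      have "\<bar>P i j - S (\<upsilon> k) j\<bar> \<le> K / \<kappa> * ?d" if "j < n" for j
      proof -
        have mem: "(\<lambda>j. P i j - S (\<upsilon> k) j) \<in> V"
          unfolding V_def using i \<open>\<upsilon> k < Q\<close> by (intro image_eqI[of _ _ "(i, \<upsilon> k)"]) auto
        have "\<bar>P i j - S (\<upsilon> k) j\<bar> \<le> K * \<bar>moment n t (\<lambda>j. P i j - S (\<upsilon> k) j)\<bar>"
          using t(2)[THEN bspec, OF mem, THEN spec, of j] that by simp
        also have "\<dots> \<le> K * (?d / \<kappa>)"
          using m K by (intro mult_left_mono) (simp_all add: moment_diff)
        finally show ?thesis by simp
      qed
      then show ?thesis by (simp add: close_def k_def)
    qed
    moreover have "\<upsilon> \<circ> inv \<tau> permutes {..<Q}"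
      using \<tau>(1) \<upsilon>(1) by (intro permutes_compose permutes_inv)
    ultimately show ?thesis unfolding matched_def by blast
  qed
  moreover have "K / \<kappa> \<ge> 0" using K assms by simp
  ultimately show ?thesis by blast
qed

section \<open>Existence of a nearest tuple\<close>

lemma bounded_family_convergent_subsequence:
  fixes f :: "nat \<Rightarrow> 'a \<Rightarrow> real"
  assumes "finite A" "\<And>a k. a \<in> A \<Longrightarrow> \<bar>f k a\<bar> \<le> B a"
  shows "\<exists>g l. strict_mono g \<and> (\<forall>a\<in>A. (\<lambda>k. f (g k) a) \<longlonglongrightarrow> l a)"
  using assms
proof (induction A)
  case empty
  show ?case using strict_mono_id by auto
next
  case (insert a A)
  then obtain g l where g: "strict_mono g" "\<forall>a\<in>A. (\<lambda>k. f (g k) a) \<longlonglongrightarrow> l a" by blast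
  have "bounded (range (\<lambda>k. f (g k) a))"
    using insert.prems by (auto simp: bounded_iff)
  then obtain m h where h: "strict_mono h" "((\<lambda>k. f (g k) a) \<circ> h) \<longlonglongrightarrow> m"
    using bounded_imp_convergent_subsequence by blast
  have "(\<lambda>k. f ((g \<circ> h) k) b) \<longlonglongrightarrow> (l(a := m)) b" if "b \<in> insert a A" for b
  proof (cases "b = a")
    case True
    then show ?thesis using h(2) by (simp add: o_def)
  next
    case False
    then have "(\<lambda>k. f (g k) b) \<longlonglongrightarrow> l b" using g(2) that by blast
    from LIMSEQ_subseq_LIMSEQ[OF this h(1)] False show ?thesis by (simp add: o_def)
  qed
  then show ?case
    using strict_mono_o[OF g(1) h(1)] by blast
qed

text \<open>
  The atoms of a minimizing sequence may be renumbered so that they stay near those of its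
  first tuple; then they are bounded and Bolzano-Weierstrass applies. For the distance to the
  image of the embedding this also shows that the image is closed, so that distance 0 means membership.
\<close>
lemma exists_nearest_tuple:
  fixes c :: "(nat \<Rightarrow> nat \<Rightarrow> real) \<Rightarrow> real"
  assumes nonneg: "\<And>P. 0 \<le> c P"
    and match: "\<And>P S. matched Q n (c P + c S) P S"
    and lip: "\<And>P S e. matched Q n e P S \<Longrightarrow> c P \<le> c S + L * e"
  shows "\<exists>P. \<forall>S. c P \<le> c S"
proof -
  define m where "m = Inf (range c)"
  have bdd: "bdd_below (range c)" using nonneg by (intro bdd_belowI[of _ 0]) auto
  have m_le: "m \<le> c P" for P unfolding m_def using bdd by (intro cInf_lower) auto
  have "\<exists>P. c P < m + inverse (real (Suc k))" for k
    using cInf_lessD[of "range c" "m + inverse (real (Suc k))"] by (auto simp: m_def)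
  then obtain R where R: "\<And>k. c (R k) < m + inverse (real (Suc k))" by metis
  have "\<exists>\<sigma>. \<sigma> permutes {..<Q} \<and> (\<forall>i<Q. close n (c (R 0) + c (R k)) (R 0 i) (R k (\<sigma> i)))" for k
    using match[of "R 0" "R k"] by (simp add: matched_def)
  then obtain \<sigma> where \<sigma>: "\<And>k. \<sigma> k permutes {..<Q}"
      "\<And>k i. i < Q \<Longrightarrow> close n (c (R 0) + c (R k)) (R 0 i) (R k (\<sigma> k i))"
    by metis
  define T where "T k i = R k (\<sigma> k i)" for k i
  have cR: "c (R k) \<le> m + 1" for k
    using R[of k] by (smt (verit) inverse_le_1_iff of_nat_1 of_nat_le_iff le_add1 plus_1_eq_Suc)
  have bound: "\<bar>T k (fst p) (snd p)\<bar> \<le> \<bar>R 0 (fst p) (snd p)\<bar> + (c (R 0) + (m + 1))"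
    if "p \<in> {..<Q} \<times> {..<n}" for p k
  proof -
    have "\<bar>R 0 (fst p) (snd p) - T k (fst p) (snd p)\<bar> \<le> c (R 0) + c (R k)"
      using \<sigma>(2)[of "fst p" k] that by (auto simp: close_def T_def)
    then show ?thesis using cR[of k] by linarith
  qed
  obtain g l where g: "strict_mono g"
      "\<forall>p\<in>{..<Q} \<times> {..<n}. (\<lambda>k. T (g k) (fst p) (snd p)) \<longlonglongrightarrow> l p"
    using bounded_family_convergent_subsequence[of "{..<Q} \<times> {..<n}" "\<lambda>k p. T k (fst p) (snd p)"
        "\<lambda>p. \<bar>R 0 (fst p) (snd p)\<bar> + (c (R 0) + (m + 1))"] bound by auto
  define P where "P i j = l (i, j)" for i j
  define e where "e k = (\<Sum>p\<in>{..<Q} \<times> {..<n}. \<bar>T (g k) (fst p) (snd p) - l p\<bar>)" for k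
  have "(\<lambda>k. e k) \<longlonglongrightarrow> (\<Sum>p\<in>{..<Q} \<times> {..<n}. \<bar>l p - l p\<bar>)"
    unfolding e_def using g(2) by (intro tendsto_sum tendsto_rabs tendsto_diff) auto
  then have e0: "e \<longlonglongrightarrow> 0" by simp
  have "c P \<le> m + inverse (real (Suc k)) + L * e k" for k
  proof -
    have "close n (e k) (P i) (R (g k) (\<sigma> (g k) i))" if i: "i < Q" for i
    proof -
      have "\<bar>P i j - T (g k) i j\<bar> \<le> e k" if "j < n" for j
        unfolding e_def P_def
        using member_le_sum[of "(i, j)" "{..<Q} \<times> {..<n}" "\<lambda>p. \<bar>T (g k) (fst p) (snd p) - l p\<bar>"]
          i that by (simp add: abs_minus_commute)
      then show ?thesis by (simp add: close_def T_def)
    qed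
    then have "matched Q n (e k) P (R (g k))"
      unfolding matched_def using \<sigma>(1)[of "g k"] by blast
    then have "c P \<le> c (R (g k)) + L * e k" by (rule lip)
    moreover have "inverse (real (Suc (g k))) \<le> inverse (real (Suc k))"
      using seq_suble[OF g(1), of k] by simp
    ultimately show ?thesis using R[of "g k"] by linarith
  qed
  moreover have "(\<lambda>k. m + inverse (real (Suc k)) + L * e k) \<longlonglongrightarrow> m + 0 + L * 0"
    by (intro tendsto_intros e0 LIMSEQ_inverse_real_of_nat)
  ultimately have "c P \<le> m"
    by (intro LIMSEQ_le_const[of "\<lambda>k. m + inverse (real (Suc k)) + L * e k"]) auto
  then show ?thesis using m_le order_trans by blast
qed

section \<open>The retraction\<close>

text \<open>
  Here \<open>c\<close> stands for the rescaled distance of the tuples from a point of the ambient space. The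
  threshold \<open>2 * s\<close> is the one for which any two tuples of cost at most \<open>s\<close> have their atoms paired by
  links.
\<close>
definition linked ::
    "nat \<Rightarrow> nat \<Rightarrow> ((nat \<Rightarrow> nat \<Rightarrow> real) \<Rightarrow> real) \<Rightarrow> real \<Rightarrow> (nat \<Rightarrow> real) \<Rightarrow> (nat \<Rightarrow> real) \<Rightarrow> bool"
  where "linked Q n c s a b \<longleftrightarrow>
    (\<exists>P i. i < Q \<and> c P \<le> s \<and> a = P i) \<and> (\<exists>S k. k < Q \<and> c S \<le> s \<and> b = S k) \<and> close n (2 * s) a b"

text \<open>
  The closure is transitive but not reflexive: a point that is not yet active at level \<open>s\<close>
  belongs to no cluster, not even its own. Otherwise the infimum in the next definition would
  range over arbitrarily low levels.
\<close>
abbreviation clustered ::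
    "nat \<Rightarrow> nat \<Rightarrow> ((nat \<Rightarrow> nat \<Rightarrow> real) \<Rightarrow> real) \<Rightarrow> real \<Rightarrow> (nat \<Rightarrow> real) \<Rightarrow> (nat \<Rightarrow> real) \<Rightarrow> bool"
  where "clustered Q n c s \<equiv> (linked Q n c s)\<^sup>+\<^sup>+"

definition slope :: "nat \<Rightarrow> real"
  where "slope Q = 6 * real (Q * Q) + 2"

definition settle ::
    "nat \<Rightarrow> nat \<Rightarrow> ((nat \<Rightarrow> nat \<Rightarrow> real) \<Rightarrow> real) \<Rightarrow> (nat \<Rightarrow> real) \<Rightarrow> nat \<Rightarrow> real"
  where "settle Q n c a j =
    (if j < n then Inf {b j + slope Q * s | b s. clustered Q n c s a b} else 0)"

lemma slope_nonneg: "0 \<le> slope Q"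
  by (simp add: slope_def)

text \<open>
  The clusters for two costs that differ by at most \<open>d\<close> are interleaved with shift \<open>d\<close>. With \<open>c' = c\<close> this
  says that clusters grow with the level.
\<close>
lemma linked_mono:
  assumes "linked Q n c s a b" "s \<le> s'" "\<And>P. c' P \<le> c P + (s' - s)"
  shows "linked Q n c' s' a b"
proof -
  have "c' P \<le> s'" if "c P \<le> s" for P
    using assms(3)[of P] that by linarith
  then show ?thesis
    using assms(1,2) close_mono[of n "2 * s" a b "2 * s'"] unfolding linked_def by auto
qed

lemma clustered_mono:
  assumes "clustered Q n c s a b" "s \<le> s'" "\<And>P. c' P \<le> c P + (s' - s)"
  shows "clustered Q n c' s' a b"
proof -
  have link: "linked Q n c' s' u v" if "linked Q n c s u v" for u v
    using that assms(2,3) by (rule linked_mono)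
  show ?thesis
    using assms(1)
  proof (induction rule: tranclp_induct)
    case (base b)
    then show ?case using link by blast
  next
    case (step b z)
    then show ?case using link by (meson tranclp.trancl_into_trancl)
  qed
qed

lemma clustered_activeD:
  assumes "clustered Q n c s a b"
  obtains P i where "i < Q" "c P \<le> s" "a = P i"
  using tranclpD[OF assms] by (auto simp: linked_def)

lemma close_of_relpow:
  assumes "(i, k) \<in> {(i, k). i < Q \<and> k < Q \<and> close n e (P i) (P k)} ^^ m"
  shows "close n (real m * e) (P i) (P k)"
  using assms
proof (induction m arbitrary: k)
  case 0
  then show ?case by (simp add: close_def)
next
  case (Suc m)
  then obtain l where "close n (real m * e) (P i) (P l)" "close n e (P l) (P k)" by auto
  from close_trans[OF this] show ?case by (simp add: algebra_simps)
qed

text \<open>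
  Fix a tuple \<open>P\<close> active at level \<open>s\<close>. Every active point is within \<open>2 * s\<close> of an atom of \<open>P\<close>, so a
  chain of links projects to a chain of atoms of \<open>P\<close> with steps at most \<open>6 * s\<close>. Among \<open>Q\<close> atoms
  it can be shortened to at most \<open>Q * Q\<close> steps, whatever the length of the original chain.
\<close>
lemma clustered_close:
  assumes nonneg: "\<And>P. 0 \<le> c P"
    and match: "\<And>P S. matched Q n (c P + c S) P S"
    and ab: "clustered Q n c s a b"
  shows "close n (slope Q * s) a b"
proof -
  obtain P i where P: "i < Q" "c P \<le> s" "a = P i"
    using clustered_activeD[OF ab] by metis
  have "s \<ge> 0" using nonneg[of P] P(2) by linarith
  define R where "R = {(i, k). i < Q \<and> k < Q \<and> close n (6 * s) (P i) (P k)}"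
  have near: "\<exists>k<Q. close n (2 * s) (P k) b" if db: "linked Q n c s d b" for b d
  proof -
    obtain S l where S: "l < Q" "c S \<le> s" "b = S l" using db by (auto simp: linked_def)
    have "matched Q n (2 * s) S P"
      using matched_mono[OF match[of S P]] S(2) P(2) by simp
    then obtain \<sigma> where \<sigma>: "\<sigma> permutes {..<Q}" "\<forall>i<Q. close n (2 * s) (S i) (P (\<sigma> i))"
      by (auto simp: matched_def)
    then have "\<sigma> l < Q" using permutes_in_image[OF \<sigma>(1), of l] S(1) by simp
    with \<sigma>(2) S(1,3) show ?thesis using close_sym by blast
  qed
  have "\<exists>k<Q. close n (2 * s) (P k) b \<and> (i, k) \<in> R\<^sup>*"
    using ab
  proof (induction rule: tranclp_induct)
    case (base b)
    obtain k where k: "k < Q" "close n (2 * s) (P k) b" using near base by blast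
    have "close n (2 * s + 2 * s) (P i) (P k)"
      using base P(3) k(2) by (intro close_trans[OF _ close_sym]) (auto simp: linked_def)
    then have "(i, k) \<in> R"
      using k P(1) \<open>s \<ge> 0\<close> by (auto simp: R_def elim: close_mono)
    then show ?case using k by blast
  next
    case (step b d)
    then obtain k where k: "k < Q" "close n (2 * s) (P k) b" "(i, k) \<in> R\<^sup>*" by blast
    obtain k' where k': "k' < Q" "close n (2 * s) (P k') d" using near step by blast
    have "close n (2 * s) b d" using step by (simp add: linked_def)
    from close_trans[OF close_trans[OF k(2) this] close_sym[OF k'(2)]]
    have "(k, k') \<in> R" using k k' by (simp add: R_def)
    then show ?case using k k' by (meson rtrancl.rtrancl_into_rtrancl)
  qed
  then obtain k where k: "k < Q" "close n (2 * s) (P k) b" "(i, k) \<in> R\<^sup>*" by blast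
  have sub: "R \<subseteq> {..<Q} \<times> {..<Q}" by (auto simp: R_def)
  then have fin: "finite R" using finite_subset by blast
  obtain m where m: "m \<le> card R" "(i, k) \<in> R ^^ m"
    using k(3) rtrancl_finite_eq_relpow[OF fin] by auto
  have "card R \<le> Q * Q"
    using card_mono[OF _ sub] by (simp add: card_cartesian_product)
  then have "real m * (6 * s) \<le> real (Q * Q) * (6 * s)"
    using m(1) \<open>s \<ge> 0\<close> by (intro mult_right_mono of_nat_mono) auto
  then have "close n (real (Q * Q) * (6 * s)) (P i) (P k)"
    using close_of_relpow m(2) close_mono unfolding R_def by blast
  from close_trans[OF this k(2)] show ?thesis
    by (simp add: P(3) slope_def algebra_simps)
qed

lemma clustered_lower_bound:
  assumes "\<And>P. 0 \<le> c P" "\<And>P S. matched Q n (c P + c S) P S" "j < n"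
    and "clustered Q n c s a b"
  shows "a j \<le> b j + slope Q * s"
  using clustered_close[OF assms(1,2,4)] assms(3) by (auto simp: close_def abs_le_iff algebra_simps)

lemma settle_le:
  assumes "\<And>P. 0 \<le> c P" "\<And>P S. matched Q n (c P + c S) P S" "j < n"
    and "clustered Q n c s a b"
  shows "settle Q n c a j \<le> b j + slope Q * s"
proof -
  have "bdd_below {b j + slope Q * s | b s. clustered Q n c s a b}"
    using clustered_lower_bound[OF assms(1-3)] by (intro bdd_belowI[of _ "a j"]) auto
  then show ?thesis
    unfolding settle_def using assms(3,4) by (auto intro: cInf_lower)
qed

lemma le_settle:
  assumes "clustered Q n c s a b" "j < n"
    and "\<And>b s. clustered Q n c s a b \<Longrightarrow> z \<le> b j + slope Q * s"
  shows "z \<le> settle Q n c a j"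
  unfolding settle_def using assms by (auto intro!: cInf_greatest)

lemma clustered_refl:
  assumes "\<And>P. 0 \<le> c P" "i < Q"
  shows "clustered Q n c (c P) (P i) (P i)"
  using assms by (intro tranclp.r_into_trancl) (auto simp: linked_def close_def)

lemma settle_eq:
  assumes "\<And>P. 0 \<le> c P" "\<And>P S. matched Q n (c P + c S) P S" "c P = 0" "i < Q" "j < n"
  shows "settle Q n c (P i) j = P i j"
proof (rule antisym)
  have cl: "clustered Q n c 0 (P i) (P i)"
    using clustered_refl[of c i Q n P] assms by simp
  show "settle Q n c (P i) j \<le> P i j"
    using settle_le[OF assms(1,2,5) cl] by simp
  show "P i j \<le> settle Q n c (P i) j"
    using cl assms(5) clustered_lower_bound[OF assms(1,2,5)] by (rule le_settle)
qed

text \<open>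
  Levels below \<open>c P\<close>, the least cost, carry no clusters. Hence any level \<open>s\<close> that contributes to the
  infimum for \<open>a'\<close> and \<open>c'\<close> satisfies \<open>c P \<le> s + d\<close>, and at level \<open>s + 3 * d\<close> of \<open>c\<close> the clusters of
  \<open>a\<close> and \<open>a'\<close> have merged.
\<close>
lemma settle_le_settle:
  assumes c: "\<And>P. 0 \<le> c P" "\<And>P S. matched Q n (c P + c S) P S"
    and diff: "\<And>P. \<bar>c P - c' P\<bar> \<le> d"
    and min: "\<And>S. c P \<le> c S"
    and active: "clustered Q n c' t a' a'"
    and aa': "clustered Q n c (c P + 2 * d) a a'"
    and j: "j < n"
  shows "settle Q n c a j \<le> settle Q n c' a' j + slope Q * (3 * d)"
proof -
  have "d \<ge> 0" using diff[of P] by linarith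
  have "settle Q n c a j - slope Q * (3 * d) \<le> settle Q n c' a' j"
  proof (rule le_settle[OF active j])
    fix b s assume b: "clustered Q n c' s a' b"
    obtain S k where S: "c' S \<le> s" using clustered_activeD[OF b] by metis
    have level: "c P + 2 * d \<le> s + 3 * d"
      using S diff[of S] min[of S] by linarith
    have "clustered Q n c (s + 3 * d) a' b"
      using b
    proof (rule clustered_mono)
      show "c P \<le> c' P + (s + 3 * d - s)" for P
        using diff[of P] \<open>d \<ge> 0\<close> by linarith
    qed (use \<open>d \<ge> 0\<close> in simp)
    moreover have "clustered Q n c (s + 3 * d) a a'"
      by (rule clustered_mono[OF aa' level]) (use level in simp)
    ultimately have "clustered Q n c (s + 3 * d) a b" by (rule tranclp_trans[rotated])
    from settle_le[OF c j this]
    show "settle Q n c a j - slope Q * (3 * d) \<le> b j + slope Q * s"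
      by (simp add: algebra_simps)
  qed
  then show ?thesis by simp
qed

text \<open>
  The two minimizers may be far apart in comparison with \<open>d\<close>, so their atoms cannot be compared
  directly; but each minimizer has cost within \<open>2 * d\<close> of the least for the other cost,
  so paired atoms are already linked there, and settling them brings them together.
\<close>
lemma settle_lipschitz:
  assumes c: "\<And>P. 0 \<le> c P" "\<And>P S. matched Q n (c P + c S) P S"
    and c': "\<And>P. 0 \<le> c' P" "\<And>P S. matched Q n (c' P + c' S) P S"
    and diff: "\<And>P. \<bar>c P - c' P\<bar> \<le> d"
    and min: "\<And>S. c P \<le> c S" "\<And>S. c' P' \<le> c' S"
  shows "matched Q n (slope Q * (3 * d)) (\<lambda>i. settle Q n c (P i)) (\<lambda>i. settle Q n c' (P' i))"
proof -
  have d: "d \<ge> 0" using diff[of P] by linarith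
  have cP': "c P' \<le> c' P' + d" "c P' \<le> c P + 2 * d" and c'P: "c' P \<le> c P + d" "c' P \<le> c' P' + 2 * d"
    and cP: "c P \<le> c' P' + d"
    using diff[of P] diff[of P'] min(1)[of P'] min(2)[of P] by linarith+
  obtain \<sigma> where \<sigma>: "\<sigma> permutes {..<Q}" "\<forall>i<Q. close n (c P + c P') (P i) (P' (\<sigma> i))"
    using c(2)[of P P'] by (auto simp: matched_def)
  have "close n (slope Q * (3 * d)) (settle Q n c (P i)) (settle Q n c' (P' (\<sigma> i)))" if i: "i < Q" for i
  proof -
    have \<sigma>i: "\<sigma> i < Q" using permutes_in_image[OF \<sigma>(1), of i] i by simp
    have PP': "close n (c P + c P') (P i) (P' (\<sigma> i))" using \<sigma>(2) i by blast
    have le: "c P + c P' \<le> 2 * (c P + 2 * d)" "c P + c P' \<le> 2 * (c' P' + 2 * d)"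
      using cP' cP d by (simp_all add: algebra_simps)
    have "linked Q n c (c P + 2 * d) (P i) (P' (\<sigma> i))"
      unfolding linked_def
    proof (intro conjI exI)
      show "close n (2 * (c P + 2 * d)) (P i) (P' (\<sigma> i))"
        by (rule close_mono[OF PP' le(1)])
    qed (use i \<sigma>i d cP' in auto)
    then have 1: "clustered Q n c (c P + 2 * d) (P i) (P' (\<sigma> i))" by blast
    have "linked Q n c' (c' P' + 2 * d) (P' (\<sigma> i)) (P i)"
      unfolding linked_def
    proof (intro conjI exI)
      show "close n (2 * (c' P' + 2 * d)) (P' (\<sigma> i)) (P i)"
        by (rule close_mono[OF close_sym[OF PP'] le(2)])
    qed (use i \<sigma>i d c'P in auto)
    then have 2: "clustered Q n c' (c' P' + 2 * d) (P' (\<sigma> i)) (P i)" by blast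
    have diff': "\<bar>c' S - c S\<bar> \<le> d" for S using diff[of S] by (simp add: abs_minus_commute)
    have active: "clustered Q n c (c P) (P i) (P i)" "clustered Q n c' (c' P') (P' (\<sigma> i)) (P' (\<sigma> i))"
      using clustered_refl[of c, OF c(1) i] clustered_refl[of c', OF c'(1) \<sigma>i] by blast+
    have "settle Q n c (P i) j \<le> settle Q n c' (P' (\<sigma> i)) j + slope Q * (3 * d)" if "j < n" for j
      using active(2) 1 that by (rule settle_le_settle[OF c diff min(1)])
    moreover have "settle Q n c' (P' (\<sigma> i)) j \<le> settle Q n c (P i) j + slope Q * (3 * d)" if "j < n" for j
      using active(1) 2 that by (rule settle_le_settle[OF c' diff' min(2)])
    ultimately have "\<bar>settle Q n c (P i) j - settle Q n c' (P' (\<sigma> i)) j\<bar> \<le> slope Q * (3 * d)"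
      if "j < n" for j
      using that by (fastforce simp: abs_le_iff algebra_simps)
    then show ?thesis by (simp add: close_def)
  qed
  then show ?thesis unfolding matched_def using \<sigma>(1) by blast
qed

lemma dirac_sum_eq_of_matched_0:
  assumes "matched Q n 0 P S" "\<forall>i<Q. P i \<in> Rn n" "\<forall>i<Q. S i \<in> Rn n"
  shows "dirac_sum Q P = dirac_sum Q S"
proof -
  obtain \<sigma> where \<sigma>: "\<sigma> permutes {..<Q}" "\<forall>i<Q. close n 0 (P i) (S (\<sigma> i))"
    using assms(1) by (auto simp: matched_def)
  have "P i = S (\<sigma> i)" if "i < Q" for i
  proof
    fix j
    have "\<sigma> i < Q" using permutes_in_image[OF \<sigma>(1), of i] that by simp
    then show "P i j = S (\<sigma> i) j"
      using \<sigma>(2) assms(2,3) that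
      by (cases "j < n") (auto simp: close_def topspace_Euclidean_space)
  qed
  then have "dirac_sum Q P = (\<Sum>i<Q. {#S (\<sigma> i)#})" by (simp add: dirac_sum_def)
  also have "\<dots> = dirac_sum Q S"
    unfolding dirac_sum_def using sum.permute[OF \<sigma>(1), of "\<lambda>i. {#S i#}"] by (simp add: o_def)
  finally show ?thesis .
qed

text \<open>
  The costs of all tuples vary with \<open>x\<close> by at most \<open>K\<close> times the displacement, at the same time for
  all tuples, which is what comparing the settled nearest tuples requires.
\<close>
lemma almgren_retraction:
  assumes \<kappa>: "\<kappa> \<ge> 0" and K_pos: "K > 0"
    and match: "\<And>P S. matched Q n (K * edist (edim Q n) (almgren Q n \<kappa> (dirac_sum Q P)) (almgren Q n \<kappa> (dirac_sum Q S))) P S"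
  shows "\<exists>\<rho> L. \<rho> ` Rn (edim Q n) \<subseteq> almgren Q n \<kappa> ` AQ Q n \<and>
      Lip_le L (Rn (edim Q n)) (edist (edim Q n)) (edist (edim Q n)) \<rho> \<and>
      (\<forall>x \<in> almgren Q n \<kappa> ` AQ Q n. \<rho> x = x)"
proof -
  let ?N = "edim Q n"
  let ?\<xi> = "\<lambda>P. almgren Q n \<kappa> (dirac_sum Q P)"
  have K: "K \<ge> 0" using K_pos by simp
  define lip where "lip = real ?N * (\<kappa> * (real n * real (Suc (nodes Q n)) ^ n))"
  have lip0: "lip \<ge> 0" using \<kappa> by (simp add: lip_def)
  have \<xi>_lip: "edist ?N (?\<xi> P) (?\<xi> S) \<le> lip * e" if "matched Q n e P S" for P S e
    using almgren_lipschitz[OF that \<kappa>] by (simp add: lip_def mult.assoc)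
  define c where "c x P = K * edist ?N x (?\<xi> P)" for x P
  have c0: "0 \<le> c x P" for x P using K by (simp add: c_def edist_nonneg)
  have c_match: "matched Q n (c x P + c x S) P S" for x P S
  proof (rule matched_mono[OF match])
    have "edist ?N (?\<xi> P) (?\<xi> S) \<le> edist ?N x (?\<xi> P) + edist ?N x (?\<xi> S)"
      using edist_triangle[of ?N "?\<xi> P" "?\<xi> S" x] by (simp add: edist_commute)
    then show "K * edist ?N (?\<xi> P) (?\<xi> S) \<le> c x P + c x S"
      using K by (simp add: c_def mult_left_mono flip: distrib_left)
  qed
  have "\<exists>P. \<forall>S. c x P \<le> c x S" for x
  proof (rule exists_nearest_tuple[OF c0 c_match])
    fix P S e assume m: "matched Q n e P S"
    have "edist ?N x (?\<xi> P) \<le> edist ?N x (?\<xi> S) + lip * e"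
      using edist_triangle[of ?N x "?\<xi> P" "?\<xi> S"] \<xi>_lip[OF m] by (simp add: edist_commute)
    then show "c x P \<le> c x S + K * lip * e"
      using mult_left_mono[OF _ K] by (force simp: c_def algebra_simps)
  qed
  then obtain nearest where nearest: "\<And>x S. c x (nearest x) \<le> c x S" by metis
  define target where "target x i = settle Q n (c x) (nearest x i)" for x i
  define \<rho> where "\<rho> x = ?\<xi> (target x)" for x
  have "\<rho> x \<in> almgren Q n \<kappa> ` AQ Q n" for x
    unfolding \<rho>_def AQ_def target_def
    by (intro imageI CollectI exI conjI refl) (auto simp: settle_def topspace_Euclidean_space)
  moreover have "Lip_le (lip * (slope Q * (3 * K))) (Rn ?N) (edist ?N) (edist ?N) \<rho>"
    unfolding Lip_le_def
  proof (intro conjI ballI)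
    show "0 \<le> lip * (slope Q * (3 * K))"
      using lip0 K by (simp add: slope_nonneg)
    fix x y
    have "\<bar>c x P - c y P\<bar> \<le> K * edist ?N x y" for P
    proof -
      have "\<bar>edist ?N x (?\<xi> P) - edist ?N y (?\<xi> P)\<bar> \<le> edist ?N x y"
        using edist_triangle[of ?N x "?\<xi> P" y] edist_triangle[of ?N y "?\<xi> P" x]
        by (simp add: edist_commute abs_le_iff)
      then show ?thesis
        using K by (simp add: c_def abs_mult mult_left_mono flip: right_diff_distrib)
    qed
    from settle_lipschitz[OF c0 c_match c0 c_match this nearest nearest]
    have "matched Q n (slope Q * (3 * (K * edist ?N x y))) (target x) (target y)"
      by (simp add: target_def[abs_def])
    from \<xi>_lip[OF this] show "edist ?N (\<rho> x) (\<rho> y) \<le> lip * (slope Q * (3 * K)) * edist ?N x y"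
      by (simp add: \<rho>_def algebra_simps)
  qed
  moreover have "\<rho> x = x" if x: "x \<in> almgren Q n \<kappa> ` AQ Q n" for x
  proof -
    obtain P where P: "x = ?\<xi> P" using x by (auto simp: AQ_def)
    have "c x P = 0" by (simp add: c_def P edist_self)
    then have near0: "c x (nearest x) = 0" using nearest[of x P] c0[of x "nearest x"] by simp
    then have "edist ?N x (?\<xi> (nearest x)) = 0" using K_pos by (simp add: c_def)
    then have "\<bar>x j - ?\<xi> (nearest x) j\<bar> \<le> 0" if "j < ?N" for j
      using close_edist[of ?N x "?\<xi> (nearest x)"] that by (simp add: close_def)
    then have eq: "x = ?\<xi> (nearest x)"
      by (intro ext) (metis P abs_le_zero_iff eq_iff_diff_eq_0 almgren_def)
    have "close n 0 (target x i) (nearest x i)" if "i < Q" for i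
      using settle_eq[OF c0 c_match near0 that] by (simp add: close_def target_def)
    then have "matched Q n 0 (target x) (nearest x)"
      unfolding matched_def using permutes_id by (intro exI[of _ id]) simp
    from \<xi>_lip[OF this] have "edist ?N (\<rho> x) x \<le> 0" using eq by (simp add: \<rho>_def)
    then have "\<bar>\<rho> x j - x j\<bar> \<le> 0" if "j < ?N" for j
      using close_edist[of ?N "\<rho> x" x] that by (force simp: close_def)
    then show ?thesis
      by (intro ext) (metis P \<rho>_def abs_le_zero_iff eq_iff_diff_eq_0 almgren_def)
  qed
  ultimately show ?thesis by blast
qed

theorem theorem2p1:
  fixes Q n :: nat
  shows "\<exists>(N :: nat) (C :: real) (\<xi> :: (nat \<Rightarrow> real) multiset \<Rightarrow> nat \<Rightarrow> real).
    \<xi> ` AQ Q n \<subseteq> Rn N \<and>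
    inj_on \<xi> (AQ Q n) \<and>
    Lip_le 1 (AQ Q n) (GQ Q n) (edist N) \<xi> \<and>
    Lip_le C (\<xi> ` AQ Q n) (edist N) (GQ Q n) (the_inv_into (AQ Q n) \<xi>) \<and>
    (\<exists>(\<rho> :: (nat \<Rightarrow> real) \<Rightarrow> nat \<Rightarrow> real) (L :: real).
      \<rho> ` Rn N \<subseteq> \<xi> ` AQ Q n \<and>
      Lip_le L (Rn N) (edist N) (edist N) \<rho> \<and>
      (\<forall>x \<in> \<xi> ` AQ Q n. \<rho> x = x))"
proof -
  let ?N = "edim Q n"
  define A where "A = real ?N * (real n * real (Suc (nodes Q n)) ^ n)"
  define \<kappa> where "\<kappa> = 1 / (A + 1)"
  have "A \<ge> 0" by (simp add: A_def)
  then have \<kappa>: "\<kappa> > 0" "A * \<kappa> \<le> 1" by (simp_all add: \<kappa>_def)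
  let ?\<xi> = "almgren Q n \<kappa>"
  obtain K0 where K0: "K0 \<ge> 0" "\<And>P S. matched Q n
     (K0 * edist ?N (?\<xi> (dirac_sum Q P)) (?\<xi> (dirac_sum Q S))) P S"
    using matched_of_almgren[OF \<kappa>(1)] by blast
  \<comment> \<open>A positive constant, so that cost 0 forces distance 0.\<close>
  define K where "K = K0 + 1"
  have K: "K > 0" using K0 by (simp add: K_def)
  have match: "matched Q n (K * edist ?N (?\<xi> (dirac_sum Q P)) (?\<xi> (dirac_sum Q S))) P S" for P S
    by (rule matched_mono[OF K0(2)]) (simp add: K_def edist_nonneg mult_right_mono)
  have inj: "inj_on ?\<xi> (AQ Q n)"
  proof (rule inj_onI)
    fix T U assume "T \<in> AQ Q n" "U \<in> AQ Q n" and eq: "?\<xi> T = ?\<xi> U"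
    then obtain P S where PS: "T = dirac_sum Q P" "\<forall>i<Q. P i \<in> Rn n"
        "U = dirac_sum Q S" "\<forall>i<Q. S i \<in> Rn n"
      by (auto simp: AQ_def)
    then have "matched Q n 0 P S" using match[of P S] eq by (simp add: edist_self)
    then show "T = U" using PS dirac_sum_eq_of_matched_0 by blast
  qed
  have sub: "?\<xi> ` AQ Q n \<subseteq> Rn ?N"
    by (auto simp: topspace_Euclidean_space almgren_def)
  have lip: "Lip_le 1 (AQ Q n) (GQ Q n) (edist ?N) ?\<xi>"
    unfolding Lip_le_def
  proof (intro conjI ballI)
    fix T U assume "T \<in> AQ Q n" "U \<in> AQ Q n"
    then obtain P S where PS: "T = dirac_sum Q P" "U = dirac_sum Q S" by (auto simp: AQ_def)
    have "edist ?N (?\<xi> T) (?\<xi> U) \<le> A * \<kappa> * matching_dist Q n P S"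
      using almgren_lipschitz[OF matched_matching_dist, of \<kappa> Q n P S] \<kappa>(1)
      by (simp add: PS A_def mult_ac)
    also have "\<dots> \<le> 1 * matching_dist Q n P S"
      using \<kappa>(2) by (intro mult_right_mono matching_dist_nonneg)
    finally show "edist ?N (?\<xi> T) (?\<xi> U) \<le> 1 * GQ Q n T U"
      by (simp add: PS GQ_dirac_sum)
  qed simp
  have inv: "Lip_le (real Q * (real n * K)) (?\<xi> ` AQ Q n) (edist ?N) (GQ Q n) (the_inv_into (AQ Q n) ?\<xi>)"
    unfolding Lip_le_def
  proof (intro conjI ballI)
    show "0 \<le> real Q * (real n * K)" using K by simp
    fix x y assume "x \<in> ?\<xi> ` AQ Q n" "y \<in> ?\<xi> ` AQ Q n"
    then obtain T U where TU: "T \<in> AQ Q n" "U \<in> AQ Q n" "x = ?\<xi> T" "y = ?\<xi> U" by blast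
    then obtain P S where PS: "T = dirac_sum Q P" "U = dirac_sum Q S" by (auto simp: AQ_def)
    have "GQ Q n T U \<le> real Q * (real n * (K * edist ?N x y))"
      using matching_dist_le_of_matched[OF match[of P S]] by (simp add: PS TU GQ_dirac_sum)
    then show "GQ Q n (the_inv_into (AQ Q n) ?\<xi> x) (the_inv_into (AQ Q n) ?\<xi> y)
        \<le> real Q * (real n * K) * edist ?N x y"
      using TU the_inv_into_f_f[OF inj] by (simp add: mult.assoc)
  qed
  show ?thesis
    using sub inj lip inv almgren_retraction[OF _ K match] \<kappa>(1) K
    by (intro exI[of _ ?N] exI[of _ "real Q * (real n * K)"] exI[of _ ?\<xi>] conjI) auto
qed

end
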